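(* Suppose $d\ge 1$ and $n\ge 4$ are integers. Then $C_n$ is $2,d$-perfect if and only if either (1) $n\le 2d+1$, or (2) $n\ge 2d+2$ and $(d+1)\mid n$.
   Context: $C_n$ is the cycle graph on $n$ vertices. All graphs are simple and undirected with nonempty vertex set. A shortest path in a graph $G$ is a path between some vertices $u,v$ whose length (number of edges) equals the graph distance between $u$ and $v$. A set $S\subseteq V(G)$ is $k,d$-independent in $G$ if every shortest path in $G$ of length at most $d$ contains fewer than $k$ vertices of $S$. The $k,d$-chromatic number $\chi^k_d(G)$ is the least positive integer $c$ such that some coloring $V(G)\to\{1,\dots,c\}$ has all color classes $k,d$-independent. A set $S\subseteq V(G)$ is a $k,d$-clique in $G$ if every $k$-element subset of $S$ is contained in some shortest path of $G$ of length at most $d$; $\omega^k_d(G)$ is the supremum of the sizes of $k,d$-cliques in $G$. For $2\le k\le d+1$, $G$ is $k,d$-perfect if $\chi^k_d(H)=\left\lceil\frac{\omega^k_d(H)}{k-1}\right\rceil$ for every induced subgraph $H$ of $G$ (shortest paths being computed in $H$). Here $k=2$. *)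

theory Defs
  imports "Graph_Theory.Graph_Theory"
begin

text \<open>
  Simple undirected graphs are the digraphs of locale \<^locale>\<open>graph\<close>: finite, loop-free, without
  parallel arcs and with a symmetric arc relation, each edge being a pair of opposite arcs.
\<close>

text \<open>The definition describes the cycle graph for \<open>n \<ge> 3\<close>.\<close>

definition cycle_graph :: "nat \<Rightarrow> nat pair_pre_digraph" where
  "cycle_graph n = \<lparr> pverts = {0..<n},
     parcs = {(i, j). i < n \<and> j < n \<and> (j = (i + 1) mod n \<or> i = (j + 1) mod n)} \<rparr>"

lemma pair_graph_cycle_graph:
  assumes "n \<ge> 3"
  shows "pair_graph (cycle_graph n)"
proof
  show "finite (pverts (cycle_graph n))"
    by (simp add: cycle_graph_def)
  show "finite (parcs (cycle_graph n))"
    by (rule finite_subset[of _ "{0..<n} \<times> {0..<n}"]) (auto simp: cycle_graph_def)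
  show "fst e \<in> pverts (cycle_graph n)" if "e \<in> parcs (cycle_graph n)" for e
    using that by (auto simp: cycle_graph_def)
  show "snd e \<in> pverts (cycle_graph n)" if "e \<in> parcs (cycle_graph n)" for e
    using that by (auto simp: cycle_graph_def)
  show "fst e \<noteq> snd e" if "e \<in> parcs (cycle_graph n)" for e
    using that assms by (auto simp: cycle_graph_def mod_Suc split: if_splits)
  show "symmetric (with_proj (cycle_graph n))"
    by (auto simp: cycle_graph_def symmetric_def sym_def)
qed

text \<open>\<open>\<mu>\<close> with unit arc weights is the graph distance, \<open>\<infinity>\<close> between different components.
  The one-vertex path (\<open>p = []\<close>, \<open>u = v\<close>) is a shortest path of length 0.\<close>

definition shortest_path :: "('a, 'b) pre_digraph \<Rightarrow> 'a \<Rightarrow> 'b list \<Rightarrow> 'a \<Rightarrow> bool" where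
  "shortest_path G u p v \<longleftrightarrow>
     pre_digraph.apath G u p v \<and> ereal (real (length p)) = wf_digraph.\<mu> G (\<lambda>_. 1) u v"

definition kd_independent :: "nat \<Rightarrow> nat \<Rightarrow> ('a, 'b) pre_digraph \<Rightarrow> 'a set \<Rightarrow> bool" where
  "kd_independent k d G S \<longleftrightarrow> S \<subseteq> verts G \<and>
     (\<forall>u p v. shortest_path G u p v \<and> length p \<le> d \<longrightarrow>
        card (set (pre_digraph.awalk_verts G u p) \<inter> S) < k)"

definition kd_clique :: "nat \<Rightarrow> nat \<Rightarrow> ('a, 'b) pre_digraph \<Rightarrow> 'a set \<Rightarrow> bool" where
  "kd_clique k d G S \<longleftrightarrow> S \<subseteq> verts G \<and>
     (\<forall>T. T \<subseteq> S \<and> card T = k \<longrightarrow>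
        (\<exists>u p v. shortest_path G u p v \<and> length p \<le> d \<and>
           T \<subseteq> set (pre_digraph.awalk_verts G u p)))"

text \<open>Meant for finite \<open>G\<close> and \<open>k \<ge> 2\<close>: then an injective coloring shows that the minimum
  exists, and the supremum below is taken over a finite nonempty set of naturals.\<close>

definition kd_chromatic_number :: "nat \<Rightarrow> nat \<Rightarrow> ('a, 'b) pre_digraph \<Rightarrow> nat" where
  "kd_chromatic_number k d G = (LEAST c. c > 0 \<and>
     (\<exists>f. f \<in> verts G \<rightarrow> {1..c} \<and>
        (\<forall>i\<in>{1..c}. kd_independent k d G {v \<in> verts G. f v = i})))"

definition kd_clique_number :: "nat \<Rightarrow> nat \<Rightarrow> ('a, 'b) pre_digraph \<Rightarrow> nat" where
  "kd_clique_number k d G = Sup {card S | S. kd_clique k d G S}"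

text \<open>Only meaningful for \<open>2 \<le> k \<le> d + 1\<close>. Graphs have a nonempty vertex set, so the empty induced
  subgraph is excluded. Paths and distances are those of \<open>H\<close>.\<close>

definition kd_perfect :: "nat \<Rightarrow> nat \<Rightarrow> ('a, 'b) pre_digraph \<Rightarrow> bool" where
  "kd_perfect k d G \<longleftrightarrow> (\<forall>H. induced_subgraph H G \<and> verts H \<noteq> {} \<longrightarrow>
     int (kd_chromatic_number k d H) = \<lceil>real (kd_clique_number k d H) / (real k - 1)\<rceil>)"

end

theory Submission
  imports Defs
begin

text \<open>
  For \<open>k = 2\<close> the two invariants are the chromatic number and the clique number of the \<open>d\<close>-th power
  of the graph, so a proper coloring with \<open>m\<close> colors together with a clique of size \<open>m\<close> determines
  both.  A proper induced subgraph of the cycle is a union of paths: there \<open>m\<close> is the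
  length of the longest run of consecutive vertices, cut off at \<open>d + 1\<close>, and the position modulo \<open>m\<close>
  is a coloring.  The whole cycle has a complete \<open>d\<close>-th power if \<open>n \<le> 2 d + 1\<close>, and the residue
  modulo \<open>d + 1\<close> is a coloring if \<open>d + 1\<close> divides \<open>n\<close>.  In the remaining case the cliques have at most
  \<open>d + 1\<close> elements, whereas a coloring with \<open>d + 1\<close> colors would be injective on each window of
  \<open>d + 1\<close> consecutive vertices, hence periodic with period \<open>d + 1\<close> around the cycle; then the vertices \<open>0\<close> and
  \<open>n mod (d + 1)\<close> would have the same color.
\<close>

section \<open>The case \<open>k = 2\<close>\<close>

text \<open>Any walk of length at most \<open>d\<close> will do, not only a shortest one, so that
  walks can be cut, joined and reversed freely; this amounts to distance at most
  \<open>d\<close>.\<close>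

definition near :: "nat \<Rightarrow> ('a, 'b) pre_digraph \<Rightarrow> 'a \<Rightarrow> 'a \<Rightarrow> bool" where
  "near d G u v \<longleftrightarrow> (\<exists>p. pre_digraph.awalk G u p v \<and> length p \<le> d)"

text \<open>These are the proper colorings of the \<open>d\<close>-th power of \<open>G\<close>; the
  conclusion \<open>u = v\<close> accounts for every vertex being near itself.\<close>

definition proper_coloring :: "nat \<Rightarrow> ('a, 'b) pre_digraph \<Rightarrow> ('a \<Rightarrow> nat) \<Rightarrow> bool" where
  "proper_coloring d G f \<longleftrightarrow>
    (\<forall>u\<in>verts G. \<forall>v\<in>verts G. near d G u v \<longrightarrow> f u = f v \<longrightarrow> u = v)"

section \<open>Walks of bounded length in symmetric digraphs\<close>

context pseudo_graph
begin

lemma awalk_rev: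
  assumes "awalk u p v"
  shows "\<exists>q. awalk v q u \<and> length q = length p"
  using assms
proof (induction p arbitrary: u)
  case Nil
  then show ?case by (auto simp: awalk_Nil_iff intro: exI[of _ "[]"])
next
  case (Cons e es)
  then have e: "e \<in> arcs G" "u = tail G e" "awalk (head G e) es v"
    by (auto simp: awalk_Cons_iff)
  obtain q where q: "awalk v q (head G e)" "length q = length es"
    using Cons.IH[OF e(3)] by blast
  obtain e' where e': "e' \<in> arcs G" "tail G e = head G e'" "head G e = tail G e'"
    using sym_arcs e(1) unfolding symmetric_conv by blast
  have "awalk (head G e) [e'] u"
    using e e' arc_implies_awalk[OF e'(1)] by simp
  then have "awalk v (q @ [e']) u"
    using q(1) awalk_appendI by blast
  then show ?case using q(2) by (intro exI[of _ "q @ [e']"]) simp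
qed

lemma near_sym: "near d G u v \<Longrightarrow> near d G v u"
  unfolding near_def using awalk_rev by metis

lemma near_refl: "u \<in> verts G \<Longrightarrow> near d G u u"
  unfolding near_def by (intro exI[of _ "[]"]) (simp add: awalk_Nil_iff)

text \<open>Cut the walk at \<open>x\<close>: \<open>y\<close> lies on one of the two halves, and
  the piece between \<open>x\<close> and \<open>y\<close> is no longer than \<open>p\<close>. If
  \<open>y\<close> comes first, the piece is reversed.\<close>

lemma near_on_awalk:
  assumes p: "awalk u p v" "length p \<le> d"
    and xy: "x \<in> set (awalk_verts u p)" "y \<in> set (awalk_verts u p)"
  shows "near d G x y"
proof -
  obtain q r where qr: "p = q @ r" "awalk u q x" "awalk x r v"
    using awalk_decomp[OF p(1) xy(1)] by blast
  have "y \<in> set (awalk_verts u q) \<or> y \<in> set (awalk_verts x r)"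
    using xy(2) qr set_awalk_verts_append by auto
  then show ?thesis
  proof
    assume "y \<in> set (awalk_verts u q)"
    then obtain q1 q2 where "q = q1 @ q2" "awalk y q2 x"
      using awalk_decomp[OF qr(2)] by blast
    then have "near d G y x"
      unfolding near_def using p(2) qr(1) by (intro exI[of _ q2]) auto
    then show ?thesis by (rule near_sym)
  next
    assume "y \<in> set (awalk_verts x r)"
    then obtain r1 r2 where "r = r1 @ r2" "awalk x r1 y"
      using awalk_decomp[OF qr(3)] by blast
    then show ?thesis
      unfolding near_def using p(2) qr(1) by (intro exI[of _ r1]) auto
  qed
qed

lemma awalk_cost_unit: "awalk_cost (\<lambda>_. 1) p = real (length p)"
  by (induction p) auto

text \<open>With unit weights cost equals length, so a path of minimum cost is no longer than the
  given walk.\<close>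

lemma near_imp_shortest_path:
  assumes "near d G u v"
  shows "\<exists>p. shortest_path G u p v \<and> length p \<le> d"
proof -
  obtain q where q: "awalk u q v" "length q \<le> d"
    using assms unfolding near_def by blast
  have "u \<rightarrow>\<^sup>* v" using q(1) reachable_awalk by blast
  then obtain p where p: "apath u p v" "\<mu> (\<lambda>_. 1) u v = awalk_cost (\<lambda>_. 1) p"
    using min_cost_awalk[of u v "\<lambda>_. 1"] by auto
  have "ereal (awalk_cost (\<lambda>_. 1) p) \<le> ereal (awalk_cost (\<lambda>_. 1) q)"
    using min_cost_le_walk_cost[OF q(1), of "\<lambda>_. 1"] p(2) by simp
  then have "length p \<le> length q" by (simp add: awalk_cost_unit)
  moreover have "shortest_path G u p v"
    unfolding shortest_path_def using p by (simp add: awalk_cost_unit)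
  ultimately show ?thesis using q(2) by auto
qed

lemma near_on_shortest_path:
  assumes "shortest_path G u p v" "length p \<le> d"
    and "x \<in> set (awalk_verts u p)" "y \<in> set (awalk_verts u p)"
  shows "near d G x y"
  using assms near_on_awalk awalkI_apath unfolding shortest_path_def by blast

text \<open>This carries independence and cliques over to \<open>near\<close>: a short walk yields a
  shortest path that has \<open>x\<close> and \<open>y\<close> as its ends.\<close>

lemma near_iff_on_shortest_path:
  "near d G x y \<longleftrightarrow> (\<exists>u p v. shortest_path G u p v \<and> length p \<le> d \<and>
    {x, y} \<subseteq> set (awalk_verts u p))"
proof
  assume "near d G x y"
  then obtain p where p: "shortest_path G x p y" "length p \<le> d"
    using near_imp_shortest_path by blast
  then have "awalk x p y" unfolding shortest_path_def using awalkI_apath by blast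
  then have "{x, y} \<subseteq> set (awalk_verts x p)"
    by (metis awalk_verts_non_Nil awhd_of_awalk awalkE' empty_subsetI hd_in_set insert_subset
        last_in_set)
  then show "\<exists>u p v. shortest_path G u p v \<and> length p \<le> d \<and> {x, y} \<subseteq> set (awalk_verts u p)"
    using p by blast
qed (auto intro: near_on_shortest_path)

lemma kd_independent_2_iff:
  "kd_independent 2 d G S \<longleftrightarrow>
    S \<subseteq> verts G \<and> (\<forall>x\<in>S. \<forall>y\<in>S. near d G x y \<longrightarrow> x = y)"
proof -
  have "card (set vs \<inter> S) < 2 \<longleftrightarrow> (\<forall>x\<in>set vs \<inter> S. \<forall>y\<in>set vs \<inter> S. x = y)" for vs :: "'a list"
    using card_le_Suc0_iff_eq[of "set vs \<inter> S"] by (simp add: less_2_cases_iff le_Suc_eq)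
  then show ?thesis
    unfolding kd_independent_def near_iff_on_shortest_path by (simp, blast)
qed

text \<open>The two-element sets \<open>T\<close> cover the pairs of distinct vertices; the case
  \<open>x = y\<close> is supplied by \<open>near_refl\<close>.\<close>

lemma kd_clique_2_iff:
  "kd_clique 2 d G S \<longleftrightarrow> S \<subseteq> verts G \<and> (\<forall>x\<in>S. \<forall>y\<in>S. near d G x y)"
proof -
  have eq: "(\<forall>T. T \<subseteq> S \<and> card T = 2 \<longrightarrow> (\<exists>u p v. shortest_path G u p v \<and> length p \<le> d \<and>
        T \<subseteq> set (awalk_verts u p))) \<longleftrightarrow>
      (\<forall>x\<in>S. \<forall>y\<in>S. x \<noteq> y \<longrightarrow> near d G x y)" (is "?L \<longleftrightarrow> ?R")
  proof
    assume L: ?L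
    show ?R
    proof (intro ballI impI)
      fix x y assume "x \<in> S" "y \<in> S" "x \<noteq> y"
      then show "near d G x y"
        using L[rule_format, of "{x, y}"] unfolding near_iff_on_shortest_path by simp
    qed
  next
    assume R: ?R
    show ?L
    proof (intro allI impI)
      fix T assume T: "T \<subseteq> S \<and> card T = 2"
      then obtain x y where "T = {x, y}" "x \<noteq> y" by (auto simp: card_2_iff)
      then show "\<exists>u p v. shortest_path G u p v \<and> length p \<le> d \<and> T \<subseteq> set (awalk_verts u p)"
        using R T near_iff_on_shortest_path[of d x y] by simp
    qed
  qed
  show ?thesis
    unfolding kd_clique_def eq by (intro conj_cong refl) (metis near_refl subsetD)
qed

section \<open>Chromatic number and clique number for \<open>k = 2\<close>\<close>

lemma kd_chromatic_number_2_eq: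
  "kd_chromatic_number 2 d G =
    (LEAST c. c > 0 \<and> (\<exists>f. f \<in> verts G \<rightarrow> {1..c} \<and> proper_coloring d G f))"
proof -
  have "(\<forall>i\<in>{1..c}. kd_independent 2 d G {v \<in> verts G. f v = i}) \<longleftrightarrow> proper_coloring d G f"
    if "f \<in> verts G \<rightarrow> {1..c}" for c :: nat and f
    using that unfolding kd_independent_2_iff proper_coloring_def by (fastforce simp: Pi_iff)
  then have "(\<exists>f. f \<in> verts G \<rightarrow> {1..c} \<and>
        (\<forall>i\<in>{1..c}. kd_independent 2 d G {v \<in> verts G. f v = i})) \<longleftrightarrow>
      (\<exists>f. f \<in> verts G \<rightarrow> {1..c} \<and> proper_coloring d G f)" for c :: nat
    by (intro ex_cong1 conj_cong refl)
  then show ?thesis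
    unfolding kd_chromatic_number_def by presburger
qed

lemma kd_clique_number_2_eq:
  assumes "kd_clique 2 d G S" and "\<And>T. kd_clique 2 d G T \<Longrightarrow> card T \<le> card S"
  shows "kd_clique_number 2 d G = card S"
  unfolding kd_clique_number_def by (rule cSup_eq_maximum) (use assms in auto)

lemma card_clique_le_colors:
  assumes "f \<in> verts G \<rightarrow> {1..c}" "proper_coloring d G f" "kd_clique 2 d G S"
  shows "card S \<le> c"
proof -
  have "inj_on f S"
    using assms(2,3) by (meson inj_onI kd_clique_2_iff proper_coloring_def subsetD)
  moreover have "f ` S \<subseteq> {1..c}"
    using assms(1,3) by (auto simp: kd_clique_2_iff Pi_iff)
  ultimately have "card S \<le> card {1..c}"
    by (rule card_inj_on_le) simp
  then show ?thesis by simp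
qed

text \<open>The coloring bounds every clique by \<open>card S\<close>, and the clique
  \<open>S\<close> forces at least \<open>card S\<close> colors, so both numbers equal
  \<open>card S\<close>.\<close>

lemma chromatic_eq_clique_number:
  assumes f: "f \<in> verts G \<rightarrow> {1..card S}" "proper_coloring d G f"
    and S: "kd_clique 2 d G S" "S \<noteq> {}"
  shows "kd_chromatic_number 2 d G = kd_clique_number 2 d G"
proof -
  have "finite S" using S(1) finite_subset[OF _ finite_verts] by (simp add: kd_clique_2_iff)
  then have "card S > 0" using S(2) by (simp add: card_gt_0_iff)
  have "kd_chromatic_number 2 d G = card S"
    unfolding kd_chromatic_number_2_eq
    by (rule Least_equality) (use f \<open>card S > 0\<close> S(1) card_clique_le_colors in auto)
  moreover have "kd_clique_number 2 d G = card S"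
    using S(1) card_clique_le_colors[OF f] by (intro kd_clique_number_2_eq)
  ultimately show ?thesis by simp
qed

text \<open>Any proper coloring at all shows that the minimum defining the chromatic number is
  attained.\<close>

lemma obtain_optimal_coloring:
  assumes "f \<in> verts G \<rightarrow> {1..c}" "c > 0" "proper_coloring d G f"
  obtains g where "g \<in> verts G \<rightarrow> {1..kd_chromatic_number 2 d G}" "proper_coloring d G g"
proof -
  have "\<exists>c>0. \<exists>f. f \<in> verts G \<rightarrow> {1..c} \<and> proper_coloring d G f"
    using assms by blast
  from LeastI_ex[OF this] show ?thesis
    using that unfolding kd_chromatic_number_2_eq by blast
qed

lemma kd_clique_number_2_le:
  assumes "\<And>S. kd_clique 2 d G S \<Longrightarrow> card S \<le> m"
  shows "kd_clique_number 2 d G \<le> m"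
proof -
  \<comment> \<open>The empty clique makes the set under the supremum nonempty, as
    \<open>cSup_least\<close> requires.\<close>
  have "kd_clique 2 d G {}" by (simp add: kd_clique_2_iff)
  then show ?thesis
    unfolding kd_clique_number_def using assms by (intro cSup_least) auto
qed

end

section \<open>Induced subgraphs of a cycle\<close>

locale cycle_induced =
  fixes n :: nat and H :: "(nat, nat \<times> nat) pre_digraph"
  assumes n_ge: "n \<ge> 3"
    and induced: "induced_subgraph H (with_proj (cycle_graph n))"
begin

sublocale pseudo_graph H
proof -
  interpret C: pair_graph "cycle_graph n" by (rule pair_graph_cycle_graph[OF n_ge])
  interpret D: digraph H using induced by (rule C.digraphI_induced)
  interpret S: sym_digraph H using induced by (rule C.induced_graph_imp_graph)
  show "pseudo_graph H" by unfold_locales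
qed

lemma tail_head_H [simp]: "tail H = fst" "head H = snd"
  using induced by (auto simp: induced_subgraph_def subgraph_def compatible_def)

lemma verts_less: "x \<in> verts H \<Longrightarrow> x < n"
  using induced by (auto simp: induced_subgraph_def subgraph_def cycle_graph_def)

section \<open>Steps along the cycle as integers modulo \<open>n\<close>\<close>

lemma vert_eqI:
  assumes "x \<in> verts H" "y \<in> verts H" "int n dvd int y - int x"
  shows "x = y"
proof -
  have "int y mod int n = int x mod int n" using assms(3) by (simp only: mod_eq_dvd_iff)
  then show ?thesis using verts_less[OF assms(1)] verts_less[OF assms(2)] by simp
qed

lemma arcs_H_iff:
  "(x, y) \<in> arcs H \<longleftrightarrow>
    x \<in> verts H \<and> y \<in> verts H \<and> (y = (x + 1) mod n \<or> x = (y + 1) mod n)"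
  using induced verts_less by (auto simp: induced_subgraph_def cycle_graph_def)

text \<open>Each arc changes the vertex by 1 or -1 modulo \<open>n\<close>; summing along the walk
  gives the signed shift \<open>k\<close>. The converse can fail when vertices are missing from
  \<open>H\<close>.\<close>

lemma near_cong:
  assumes "near d H u v"
  obtains k :: int where "\<bar>k\<bar> \<le> int d" "int n dvd int v - int u - k"
proof -
  have arc: "\<exists>k::int. \<bar>k\<bar> \<le> 1 \<and> int n dvd int y - int x - k" if "(x, y) \<in> arcs H" for x y
  proof -
    have *: "int n dvd int ((a + 1) mod n) - int a - 1" for a
    proof -
      have "int ((a + 1) mod n) mod int n = int (a + 1) mod int n"
        by (simp add: zmod_int)
      then have "int n dvd int ((a + 1) mod n) - int (a + 1)"
        by (simp only: mod_eq_dvd_iff)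
      then show ?thesis by (simp add: algebra_simps)
    qed
    have "int n dvd int y - int x - 1 \<or> int n dvd int y - int x - (-1)"
      using that *[of x] *[of y] dvd_minus_iff[of "int n" "int x - int y - 1"]
      by (auto simp: arcs_H_iff algebra_simps)
    then show ?thesis by (metis abs_1 abs_minus_cancel order_refl)
  qed
  have "\<exists>k::int. \<bar>k\<bar> \<le> int (length p) \<and> int n dvd int v - int u - k" if "awalk u p v" for u p v
    using that
  proof (induction p arbitrary: u)
    case Nil
    then show ?case by (auto simp: awalk_Nil_iff)
  next
    case (Cons e es)
    then have e: "(u, snd e) \<in> arcs H" "awalk (snd e) es v"
      by (auto simp: awalk_Cons_iff)
    obtain k where k: "\<bar>k\<bar> \<le> int (length es)" "int n dvd int v - int (snd e) - k"
      using Cons.IH[OF e(2)] by blast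
    obtain l :: int where l: "\<bar>l\<bar> \<le> 1" "int n dvd int (snd e) - int u - l"
      using arc[OF e(1)] by blast
    have "int n dvd (int v - int (snd e) - k) + (int (snd e) - int u - l)"
      using k(2) l(2) by (rule dvd_add)
    then have "int n dvd int v - int u - (k + l)" by (simp add: algebra_simps)
    then show ?case using k(1) l(1) by (intro exI[of _ "k + l"]) auto
  qed
  moreover obtain p where "awalk u p v" "length p \<le> d" using assms unfolding near_def by blast
  ultimately obtain k :: int where "\<bar>k\<bar> \<le> int (length p)" "int n dvd int v - int u - k" by blast
  then show ?thesis using \<open>length p \<le> d\<close> by (intro that[of k]) auto
qed

text \<open>The walk climbs through consecutive vertices. The indices \<open>a + j\<close> are not
  reduced, so that a run may pass from \<open>n - 1\<close> to \<open>0\<close>.\<close>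

lemma run_awalk:
  assumes "\<And>j. j \<le> l \<Longrightarrow> (a + j) mod n \<in> verts H"
  shows "\<exists>p. awalk (a mod n) p ((a + l) mod n) \<and> length p = l"
  using assms
proof (induction l)
  case 0
  then show ?case by (intro exI[of _ "[]"]) (auto simp: awalk_Nil_iff)
next
  case (Suc l)
  obtain p where p: "awalk (a mod n) p ((a + l) mod n)" "length p = l"
    using Suc by force
  have "((a + l) mod n, (a + Suc l) mod n) \<in> arcs H"
    using Suc.prems[of l] Suc.prems[of "Suc l"] by (simp add: arcs_H_iff mod_Suc_eq)
  from arc_implies_awalk[OF this]
  have "awalk (a mod n) (p @ [((a + l) mod n, (a + Suc l) mod n)]) ((a + Suc l) mod n)"
    using p(1) awalk_appendI by fastforce
  moreover have "length (p @ [((a + l) mod n, (a + Suc l) mod n)]) = Suc l"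
    using p(2) by simp
  ultimately show ?case by blast
qed

lemma run_near:
  assumes "i \<le> j" "j \<le> i + d" and "\<And>k. i \<le> k \<Longrightarrow> k \<le> j \<Longrightarrow> k mod n \<in> verts H"
  shows "near d H (i mod n) (j mod n)"
proof -
  have "\<exists>p. awalk (i mod n) p ((i + (j - i)) mod n) \<and> length p = j - i"
    using assms by (intro run_awalk) auto
  then show ?thesis unfolding near_def using assms by auto
qed

lemma run_near':
  assumes "\<bar>int i - int j\<bar> \<le> int d" and "\<And>k. min i j \<le> k \<Longrightarrow> k \<le> max i j \<Longrightarrow> k mod n \<in> verts H"
  shows "near d H (i mod n) (j mod n)"
proof (cases "i \<le> j")
  case True
  then show ?thesis using assms by (intro run_near) auto
next
  case False
  then have "near d H (j mod n) (i mod n)" using assms by (intro run_near) auto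
  then show ?thesis by (rule near_sym)
qed

section \<open>Proper induced subgraphs of the cycle\<close>

lemma chromatic_eq_clique_proper:
  assumes v: "v < n" "v \<notin> verts H" and ne: "verts H \<noteq> {}"
  shows "kd_chromatic_number 2 d H = kd_clique_number 2 d H"
proof -
  \<comment> \<open>Positions are counted upward from the missing vertex \<open>v\<close>, which
    gets position 0; this cuts the cycle open into a line.\<close>
  define pos where "pos x = (x + (n - v)) mod n" for x
  have pos_less: "pos x < n" for x using v unfolding pos_def by simp
  have vert_pos: "(v + pos x) mod n = x" if "x \<in> verts H" for x
  proof -
    have "(v + pos x) mod n = (v + (x + (n - v))) mod n"
      unfolding pos_def by (simp add: mod_add_right_eq)
    also have "v + (x + (n - v)) = x + n" using v by simp
    finally show ?thesis using verts_less[OF that] by simp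
  qed
  have pos_vert: "pos ((v + j) mod n) = j" if "j < n" for j
  proof -
    have "pos ((v + j) mod n) = (v + j + (n - v)) mod n"
      unfolding pos_def by (simp add: mod_add_left_eq)
    also have "v + j + (n - v) = j + n" using v by simp
    finally show ?thesis using that by simp
  qed
  have pos_step: "pos y = pos x + 1" if "y = (x + 1) mod n" "y \<in> verts H" for x y
  proof -
    have "pos y = (pos x + 1) mod n"
      unfolding pos_def that(1) by (simp add: mod_simps)
    \<comment> \<open>Position 0 belongs to \<open>v\<close>, which is not in \<open>H\<close>, so a
      step to the next vertex never wraps around.\<close>
    moreover have "pos y \<noteq> 0" using vert_pos[OF that(2)] v that(2) by (metis add_0_right mod_less)
    ultimately show ?thesis using pos_less[of x] by (auto simp: mod_Suc split: if_splits)
  qed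
  \<comment> \<open>A discrete intermediate value argument: the position changes by 1 per arc, so a
    walk visits every position between its ends.\<close>
  have walk: "max (pos u) (pos w) \<le> min (pos u) (pos w) + length p \<and>
      (\<forall>j. min (pos u) (pos w) \<le> j \<and> j \<le> max (pos u) (pos w) \<longrightarrow> (v + j) mod n \<in> verts H)"
    if "awalk u p w" for u p w
    using that
  proof (induction p arbitrary: u)
    case Nil
    then show ?case using vert_pos by (auto simp: awalk_Nil_iff)
  next
    case (Cons e es)
    then have e: "(u, snd e) \<in> arcs H" "awalk (snd e) es w"
      by (auto simp: awalk_Cons_iff)
    have "u \<in> verts H" using e(1) by (simp add: arcs_H_iff)
    have step: "pos (snd e) = pos u + 1 \<or> pos u = pos (snd e) + 1"
      using e(1) pos_step unfolding arcs_H_iff by blast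
    have "(v + j) mod n \<in> verts H" if "min (pos u) (pos w) \<le> j" "j \<le> max (pos u) (pos w)" for j
    proof (cases "j = pos u")
      case True
      then show ?thesis using vert_pos \<open>u \<in> verts H\<close> by simp
    next
      case False
      then have "min (pos (snd e)) (pos w) \<le> j" "j \<le> max (pos (snd e)) (pos w)"
        using step that by linarith+
      then show ?thesis using Cons.IH[OF e(2)] by blast
    qed
    then show ?case using Cons.IH[OF e(2)] step by auto
  qed

  \<comment> \<open>The bound \<open>j < n\<close> lets \<open>pos_vert\<close> apply, so that
    distinct positions of a run are distinct vertices.\<close>
  define run where "run t s \<longleftrightarrow> (\<forall>j. s \<le> j \<and> j < s + t \<longrightarrow> j < n \<and> (v + j) mod n \<in> verts H)" for t s
  \<comment> \<open>The cutoff at \<open>d + 1\<close> makes the vertices of the chosen run pairwise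
    near.\<close>
  define T where "T = {t. t \<le> d + 1 \<and> (\<exists>s. run t s)}"
  have "finite T" unfolding T_def by simp
  obtain x where "x \<in> verts H" using ne by blast
  then have "run 1 (pos x)"
    unfolding run_def using vert_pos pos_less by (metis less_Suc_eq_le Suc_eq_plus1 le_antisym)
  then have "1 \<in> T" unfolding T_def by auto
  define m where "m = Max T"
  have "m \<in> T" unfolding m_def using \<open>finite T\<close> \<open>1 \<in> T\<close> by (auto intro: Max_in)
  have "m \<ge> 1" unfolding m_def using \<open>finite T\<close> \<open>1 \<in> T\<close> by simp
  obtain s where s: "m \<le> d + 1" "run m s" using \<open>m \<in> T\<close> unfolding T_def by blast
  define S where "S = (\<lambda>j. (v + j) mod n) ` {s..<s + m}"
  have "inj_on (\<lambda>j. (v + j) mod n) {s..<s + m}"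
    by (rule inj_on_inverseI[of _ pos]) (use s pos_vert in \<open>auto simp: run_def\<close>)
  then have card_S: "card S = m" unfolding S_def by (simp add: card_image)
  have "near d H ((v + i) mod n) ((v + j) mod n)"
    if "i \<in> {s..<s + m}" "j \<in> {s..<s + m}" for i j
  proof (rule run_near')
    show "\<bar>int (v + i) - int (v + j)\<bar> \<le> int d" using that s(1) by auto
    fix k assume "min (v + i) (v + j) \<le> k" "k \<le> max (v + i) (v + j)"
    then show "k mod n \<in> verts H"
      using s(2) that unfolding run_def by (auto dest!: spec[of _ "k - v"])
  qed
  then have clique: "kd_clique 2 d H S"
    using s(2) unfolding kd_clique_2_iff S_def run_def by auto

  define f where "f x = pos x mod m + 1" for x
  have "proper_coloring d H f"
    unfolding proper_coloring_def
  proof (intro ballI impI)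
    fix u w assume uw: "u \<in> verts H" "w \<in> verts H" "near d H u w" "f u = f w"
    obtain p where p: "awalk u p w" "length p \<le> d" using uw(3) unfolding near_def by blast
    define a b where "a = min (pos u) (pos w)" and "b = max (pos u) (pos w)"
    have "a \<le> b" "b < n" "b \<le> a + d"
      unfolding a_def b_def using pos_less walk[OF p(1)] p(2) by auto
    \<comment> \<open>By \<open>walk\<close> all positions from \<open>a\<close> to \<open>b\<close>
      are occupied, so \<open>b - a < m\<close> by maximality of \<open>m\<close>; equal colors make
      \<open>m\<close> divide \<open>b - a\<close>, which leaves only \<open>b = a\<close>.\<close>
    have "run (b - a + 1) a"
      unfolding run_def using walk[OF p(1)] \<open>a \<le> b\<close> \<open>b < n\<close> unfolding a_def b_def by auto
    then have "b - a + 1 \<in> T" unfolding T_def using \<open>b \<le> a + d\<close> by auto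
    then have "b - a + 1 \<le> m" unfolding m_def using \<open>finite T\<close> by simp
    moreover have "b mod m = a mod m"
      using uw(4) unfolding f_def a_def b_def min_def max_def by auto
    then have "m dvd b - a" using \<open>a \<le> b\<close> mod_eq_dvd_iff_nat by blast
    ultimately have "b = a" using \<open>a \<le> b\<close> by (auto dest: dvd_imp_le)
    then have "pos u = pos w" unfolding a_def b_def by (auto simp: min_def max_def split: if_splits)
    then show "u = w" using vert_pos uw(1,2) by metis
  qed
  moreover have "f \<in> verts H \<rightarrow> {1..card S}"
    unfolding f_def card_S using \<open>m \<ge> 1\<close> by (auto simp: Suc_le_eq)
  moreover have "S \<noteq> {}" using card_S \<open>m \<ge> 1\<close> by auto
  ultimately show ?thesis by (intro chromatic_eq_clique_number[OF _ _ clique])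
qed

end

section \<open>The whole cycle\<close>

locale full_cycle = cycle_induced +
  assumes verts_H: "verts H = {0..<n}"
begin

lemma mod_in_verts: "k mod n \<in> verts H"
  using n_ge by (simp add: verts_H)

lemma near_full:
  assumes "i \<le> j" "j \<le> i + d"
  shows "near d H (i mod n) (j mod n)"
  using assms mod_in_verts by (intro run_near) auto

text \<open>The two ways around the cycle between \<open>x\<close> and \<open>y\<close> have total
  length \<open>n\<close>, so one of them has length at most \<open>d\<close>. Thus all vertices
  form a clique, and the injective coloring \<open>Suc\<close> matches it.\<close>

lemma chromatic_eq_clique_small:
  assumes "n \<le> 2 * d + 1"
  shows "kd_chromatic_number 2 d H = kd_clique_number 2 d H"
proof -
  have le: "near d H x y" if "x \<le> y" "y < n" for x y
  proof (cases "y \<le> x + d")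
    case True
    then show ?thesis using near_full[of x y d] that by simp
  next
    case False
    then have "near d H (y mod n) ((x + n) mod n)"
      using assms that by (intro near_full) auto
    then have "near d H y x" using that by simp
    then show ?thesis by (rule near_sym)
  qed
  then have "near d H x y" if "x < n" "y < n" for x y
    using that near_sym by (metis nat_le_linear)
  then have "kd_clique 2 d H {0..<n}" by (auto simp: kd_clique_2_iff verts_H)
  then show ?thesis
    using n_ge by (intro chromatic_eq_clique_number[of Suc "{0..<n}"])
      (auto simp: verts_H proper_coloring_def)
qed

text \<open>As \<open>d + 1\<close> divides \<open>n\<close>, residues modulo \<open>d + 1\<close>
  are consistent around the cycle: the shift \<open>k\<close> between near vertices of equal color
  is a multiple of \<open>d + 1\<close> of absolute value at most \<open>d\<close>, hence 0.\<close>

lemma chromatic_eq_clique_dvd: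
  assumes dvd: "(d + 1) dvd n"
  shows "kd_chromatic_number 2 d H = kd_clique_number 2 d H"
proof (rule chromatic_eq_clique_number)
  have "d + 1 \<le> n" using dvd n_ge by (auto intro: dvd_imp_le)
  have le: "near d H x y" if "x \<le> y" "y \<le> d" for x y
    using near_full[of x y d] that \<open>d + 1 \<le> n\<close> by simp
  then have "near d H x y" if "x \<le> d" "y \<le> d" for x y
    using that near_sym by (metis nat_le_linear)
  then show "kd_clique 2 d H {0..d}"
    using \<open>d + 1 \<le> n\<close> by (auto simp: kd_clique_2_iff verts_H)
  show "{0..d} \<noteq> {}" by simp
  show "(\<lambda>x. x mod (d + 1) + 1) \<in> verts H \<rightarrow> {1..card {0..d}}"
    by (auto simp: less_Suc_eq_le[symmetric] simp del: less_Suc_eq_le)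
  show "proper_coloring d H (\<lambda>x. x mod (d + 1) + 1)"
    unfolding proper_coloring_def
  proof (intro ballI impI)
    fix u w assume uw: "u \<in> verts H" "w \<in> verts H" "near d H u w"
      "u mod (d + 1) + 1 = w mod (d + 1) + 1"
    obtain k :: int where k: "\<bar>k\<bar> \<le> int d" "int n dvd int w - int u - k"
      using near_cong[OF uw(3)] .
    have "int (d + 1) dvd int w - int u - k"
      using dvd k(2) by (meson dvd_trans of_nat_dvd_iff)
    moreover have "int (d + 1) dvd int w - int u"
      using uw(4) by (metis add_right_cancel mod_eq_dvd_iff of_nat_mod)
    ultimately have "int (d + 1) dvd k"
      using dvd_diff[of "int (d + 1)" "int w - int u" "int w - int u - k"] by simp
    then have "k = 0" using k(1) zdvd_not_zless[of "\<bar>k\<bar>" "int (d + 1)"] by force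
    then have "int n dvd int w - int u" using k(2) by simp
    then show "u = w" by (rule vert_eqI[OF uw(1,2)])
  qed
qed

text \<open>A clique may wind around the cycle, like \<open>{0, d, 2 * d}\<close> for
  \<open>n = 3 * d\<close> and \<open>d \<ge> 2\<close>, so it need not fit into a window of
  \<open>d + 1\<close> vertices. Instead, offsets from a fixed member are shown to be distinct
  modulo \<open>d + 1\<close>.\<close>

lemma card_clique_le:
  assumes n: "n \<ge> 2 * d + 2" and S: "kd_clique 2 d H S"
  shows "card S \<le> d + 1"
proof (cases "S = {}")
  case False
  then obtain z where "z \<in> S" by blast
  have S': "S \<subseteq> {0..<n}" "\<And>x y. x \<in> S \<Longrightarrow> y \<in> S \<Longrightarrow> near d H x y"
    using S by (auto simp: kd_clique_2_iff verts_H)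
  have "\<forall>x\<in>S. \<exists>k::int. \<bar>k\<bar> \<le> int d \<and> int n dvd int x - int z - k"
    using near_cong S'(2)[OF \<open>z \<in> S\<close>] by metis
  then obtain k :: "nat \<Rightarrow> int" where
    k: "\<And>x. x \<in> S \<Longrightarrow> \<bar>k x\<bar> \<le> int d" "\<And>x. x \<in> S \<Longrightarrow> int n dvd int x - int z - k x"
    by metis
  \<comment> \<open>Offsets from \<open>z\<close> in the same residue class modulo \<open>d + 1\<close> differ by \<open>0\<close> or \<open>\<plusminus>(d + 1)\<close>, and
    in the latter case the vertices would be too far apart on both sides of the cycle.\<close>
  have "inj_on (\<lambda>x. k x mod (int d + 1)) S"
  proof (rule inj_onI)
    fix x y assume xy: "x \<in> S" "y \<in> S" "k x mod (int d + 1) = k y mod (int d + 1)"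
    obtain l :: int where l: "\<bar>l\<bar> \<le> int d" "int n dvd int y - int x - l"
      using near_cong[OF S'(2)[OF xy(1,2)]] .
    have d1: "int n dvd int y - int x - (k y - k x)"
      using dvd_diff[OF k(2)[OF xy(2)] k(2)[OF xy(1)]] by (simp add: algebra_simps)
    obtain q where q: "k y - k x = (int d + 1) * q"
      using xy(3) by (metis dvdE mod_eq_dvd_iff)
    have "(int d + 1) * \<bar>q\<bar> = \<bar>k y - k x\<bar>" unfolding q abs_mult by simp
    also have "\<dots> < 2 * int d + 2"
      using k(1)[OF xy(1)] k(1)[OF xy(2)] abs_triangle_ineq4[of "k y" "k x"] by linarith
    also have "\<dots> = (int d + 1) * 2" by simp
    finally have "\<bar>q\<bar> < 2" by (rule mult_left_less_imp_less) simp
    then have "q = 0 \<or> q = 1 \<or> q = -1" by linarith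
    \<comment> \<open>The shifts \<open>l\<close> and \<open>k y - k x\<close> are at most
      \<open>d\<close> and \<open>d + 1\<close> in absolute value, so they differ by at most
      \<open>2 * d + 1 < n\<close>; being congruent modulo \<open>n\<close>, they agree, which
      forces \<open>q = 0\<close>.\<close>
    then have small: "\<bar>l - (k y - k x)\<bar> < int n" and q0: "q \<noteq> 0 \<Longrightarrow> l \<noteq> k y - k x"
      using q l(1) n by auto
    have "int n dvd l - (k y - k x)"
      using dvd_diff[OF d1 l(2)] by (simp add: algebra_simps)
    then have "l = k y - k x"
      using small zdvd_not_zless[of "\<bar>l - (k y - k x)\<bar>" "int n"] by force
    then have "k y - k x = 0" using q0 q by auto
    then have "int n dvd int y - int x" using d1 by simp
    then show "x = y"
      using xy(1,2) S'(1) by (intro vert_eqI) (auto simp: verts_H)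
  qed
  moreover have "a mod (int d + 1) \<in> {0..int d}" for a
    using pos_mod_bound[of "int d + 1" a] by simp
  then have "(\<lambda>x. k x mod (int d + 1)) ` S \<subseteq> {0..int d}" by blast
  ultimately have "card S \<le> card {0..int d}" by (intro card_inj_on_le) auto
  then show ?thesis by simp
qed simp

lemma dvd_if_coloring:
  assumes n: "n \<ge> d + 1" and f: "f \<in> verts H \<rightarrow> {1..d + 1}" "proper_coloring d H f"
  shows "(d + 1) dvd n"
proof (rule ccontr)
  assume ndvd: "\<not> (d + 1) dvd n"
  \<comment> \<open>\<open>F\<close> unrolls the coloring to all naturals, so that windows may
    extend past \<open>n - 1\<close>.\<close>
  define F where "F i = f (i mod n)" for i
  have neq: "F i \<noteq> F j" if "i < j" "j \<le> i + d" for i j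
  proof
    assume "F i = F j"
    moreover have "near d H (i mod n) (j mod n)" using that by (intro near_full) auto
    ultimately have "i mod n = j mod n"
      using f(2) mod_in_verts unfolding proper_coloring_def F_def by blast
    then have "n dvd j - i" using that mod_eq_dvd_iff_nat[of i j n] by simp
    then show False using that n by (auto dest: dvd_imp_le)
  qed
  have F_in: "F i \<in> {1..d + 1}" for i using f(1) mod_in_verts unfolding F_def by blast
  have period: "F (i + (d + 1)) = F i" for i
  proof -
    \<comment> \<open>The window after \<open>i\<close> uses all \<open>d + 1\<close> colors, hence
      also that of \<open>i\<close>; by \<open>neq\<close> only its last index
      \<open>i + (d + 1)\<close> can have it.\<close>
    have "inj_on F {i + 1..i + (d + 1)}"
      by (rule linorder_inj_onI) (use neq in auto)
    then have "F ` {i + 1..i + (d + 1)} = {1..d + 1}"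
      using F_in by (intro card_subset_eq) (auto simp: card_image)
    then obtain j where j: "j \<in> {i + 1..i + (d + 1)}" "F i = F j" using F_in[of i] by blast
    then have "\<not> j \<le> i + d" using neq[of i j] by auto
    then show ?thesis using j by (metis add_Suc_right Suc_eq_plus1 atLeastAtMost_iff not_less_eq_eq le_antisym)
  qed
  have "F (r + (d + 1) * t) = F r" for r t
  proof (induction t)
    case (Suc t)
    then show ?case using period[of "r + (d + 1) * t"] by (simp add: algebra_simps)
  qed simp
  from this[of "n mod (d + 1)" "n div (d + 1)"]
  have "F n = F (n mod (d + 1))" by (simp only: mod_mult_div_eq)
  then have "F 0 = F (n mod (d + 1))" unfolding F_def by simp
  moreover have "0 < n mod (d + 1)" using ndvd by (simp add: mod_greater_zero_iff_not_dvd)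
  moreover have "n mod (d + 1) \<le> d" by (simp add: less_Suc_eq_le[symmetric])
  ultimately show False using neq[of 0 "n mod (d + 1)"] by simp
qed

end

theorem theorem5p9:
  fixes d n :: nat
  assumes "d \<ge> 1" and "n \<ge> 4"
  shows "kd_perfect 2 d (with_proj (cycle_graph n)) \<longleftrightarrow>
    n \<le> 2 * d + 1 \<or> (n \<ge> 2 * d + 2 \<and> (d + 1) dvd n)"
proof -
  \<comment> \<open>For \<open>k = 2\<close> the divisor \<open>real k - 1\<close> is 1, and the
    ceiling of an integer is that integer.\<close>
  have perfect_iff: "kd_perfect 2 d (with_proj (cycle_graph n)) \<longleftrightarrow>
    (\<forall>H. induced_subgraph H (with_proj (cycle_graph n)) \<and> verts H \<noteq> {} \<longrightarrow>
      kd_chromatic_number 2 d H = kd_clique_number 2 d H)"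
    unfolding kd_perfect_def by simp
  show ?thesis
  proof
    assume perfect: "kd_perfect 2 d (with_proj (cycle_graph n))"
    have "(d + 1) dvd n" if n: "n \<ge> 2 * d + 2"
    proof -
      let ?G = "with_proj (cycle_graph n)"
      have "wf_digraph ?G"
        using assms pair_graph_cycle_graph[of n]
        by (simp add: wf_digraph_wp_iff pair_graph_def pair_digraph_def pair_fin_digraph_def)
      then have refl: "induced_subgraph ?G ?G" by (rule wf_digraph.induced_subgraph_refl)
      interpret full_cycle n ?G
        using assms refl by unfold_locales (auto simp: cycle_graph_def)
      have "verts ?G \<noteq> {}" using assms verts_H by simp
      then have eq: "kd_chromatic_number 2 d ?G = kd_clique_number 2 d ?G"
        using perfect refl unfolding perfect_iff by blast
      have "Suc \<in> verts ?G \<rightarrow> {1..n}" "proper_coloring d ?G Suc" "n > 0"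
        using assms(2) verts_H unfolding proper_coloring_def by auto
      then obtain g where g: "g \<in> verts ?G \<rightarrow> {1..kd_chromatic_number 2 d ?G}"
        "proper_coloring d ?G g"
        using obtain_optimal_coloring[of Suc n d] by blast
      \<comment> \<open>Through \<open>eq\<close> this bound on cliques becomes a bound on the
        number of colors of the optimal coloring \<open>g\<close>.\<close>
      have "kd_clique_number 2 d ?G \<le> d + 1"
        using card_clique_le[OF n] by (rule kd_clique_number_2_le)
      then have "g \<in> verts ?G \<rightarrow> {1..d + 1}"
        by (intro subsetD[OF Pi_mono g(1)]) (simp add: eq)
      then show ?thesis using g(2) n by (intro dvd_if_coloring) auto
    qed
    then show "n \<le> 2 * d + 1 \<or> (n \<ge> 2 * d + 2 \<and> (d + 1) dvd n)" by linarith
  next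
    assume n: "n \<le> 2 * d + 1 \<or> (n \<ge> 2 * d + 2 \<and> (d + 1) dvd n)"
    show "kd_perfect 2 d (with_proj (cycle_graph n))"
      unfolding perfect_iff
    proof (intro allI impI, elim conjE)
      fix H assume H: "induced_subgraph H (with_proj (cycle_graph n))" "verts H \<noteq> {}"
      interpret cycle_induced n H using H assms by unfold_locales auto
      show "kd_chromatic_number 2 d H = kd_clique_number 2 d H"
      proof (cases "verts H = {0..<n}")
        case True
        then interpret full_cycle n H by unfold_locales
        show ?thesis using n chromatic_eq_clique_small chromatic_eq_clique_dvd by blast
      next
        case False
        then obtain v where "v < n" "v \<notin> verts H" using verts_less by fastforce
        then show ?thesis using chromatic_eq_clique_proper H(2) by blast
      qed
    qed
  qed
qed

end
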